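(* Let $R$ be an associative ring with $1$, let $n\ge 3$, and let $A$ and $B$ be two-sided ideals of $R$. If $A$ and $B$ are comaximal, i.e. $A+B=R$, then $$[E(n,A),E(n,B)]=E(n,R,A\circ B).$$
   Context: Rings are associative with $1$, not necessarily commutative. For $1\le i\ne j\le n$ and $c\in R$, the elementary transvection is $t_{ij}(c)=e+c\,e_{ij}\in \mathrm{GL}(n,R)$, where $e$ is the identity matrix and $e_{ij}$ the standard matrix unit. For a two-sided ideal $A$ of $R$, the (unrelative) elementary subgroup of level $A$ is $E(n,A)=\langle t_{ij}(a) : 1\le i\ne j\le n,\ a\in A\rangle$. In particular $E(n,R)$ is the absolute elementary group. The relative elementary subgroup $E(n,R,A)$ of level $A$ is the normal closure of $E(n,A)$ in $E(n,R)$. For two-sided ideals $A,B$ of $R$, $AB$ is the two-sided ideal additively generated by the products $ab$, $a\in A$, $b\in B$, and $A\circ B=AB+BA$ is the symmetrised product. For elements $x,y$ of a group, $[x,y]=xyx^{-1}y^{-1}$. For subgroups $F,H$ of a group, $[F,H]$ is the subgroup generated by all $[f,h]$ with $f\in F$, $h\in H$. *)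

theory Defs
  imports
    "HOL-Algebra.Generated_Groups"
    "HOL-Algebra.Ideal_Product"
    "Jordan_Normal_Form.Matrix"
begin

text \<open>
  Only the carrier type of matrices is taken from \<open>Jordan_Normal_Form\<close>; its product is tied to
  type-class rings and would exclude the zero ring. The product below uses the operations of the
  ring record \<open>R\<close>, which need not be commutative. Rows and columns are numbered from \<open>0\<close>.
\<close>

definition mat_monoid :: "nat \<Rightarrow> ('a, 'r) ring_scheme \<Rightarrow> 'a mat monoid" where
  "mat_monoid n R =
     \<lparr>carrier = {M \<in> carrier_mat n n. \<forall>i<n. \<forall>j<n. M $$ (i, j) \<in> carrier R},
      monoid.mult = (\<lambda>M N. mat n n (\<lambda>(i, j). \<Oplus>\<^bsub>R\<^esub>k\<in>{..<n}. M $$ (i, k) \<otimes>\<^bsub>R\<^esub> N $$ (k, j))),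
      one = mat n n (\<lambda>(i, j). if i = j then \<one>\<^bsub>R\<^esub> else \<zero>\<^bsub>R\<^esub>)\<rparr>"

definition GL :: "nat \<Rightarrow> ('a, 'r) ring_scheme \<Rightarrow> 'a mat monoid" where
  "GL n R = units_of (mat_monoid n R)"

definition transvection ::
    "nat \<Rightarrow> ('a, 'r) ring_scheme \<Rightarrow> nat \<Rightarrow> nat \<Rightarrow> 'a \<Rightarrow> 'a mat" where
  "transvection n R i j c =
     mat n n (\<lambda>(k, l). (if k = l then \<one>\<^bsub>R\<^esub> else \<zero>\<^bsub>R\<^esub>) \<oplus>\<^bsub>R\<^esub> (if k = i \<and> l = j then c else \<zero>\<^bsub>R\<^esub>))"

definition elementary :: "nat \<Rightarrow> ('a, 'r) ring_scheme \<Rightarrow> 'a set \<Rightarrow> 'a mat set" where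
  "elementary n R A =
     generate (GL n R) {transvection n R i j a | i j a. i < n \<and> j < n \<and> i \<noteq> j \<and> a \<in> A}"

definition normal_closure :: "('g, 'm) monoid_scheme \<Rightarrow> 'g set \<Rightarrow> 'g set" where
  "normal_closure G S = \<Inter>{N. N \<lhd> G \<and> S \<subseteq> N}"

definition rel_elementary :: "nat \<Rightarrow> ('a, 'r) ring_scheme \<Rightarrow> 'a set \<Rightarrow> 'a mat set" where
  "rel_elementary n R A =
     normal_closure ((GL n R)\<lparr>carrier := elementary n R (carrier R)\<rparr>) (elementary n R A)"

definition commutator :: "('g, 'm) monoid_scheme \<Rightarrow> 'g \<Rightarrow> 'g \<Rightarrow> 'g" where
  "commutator G x y = x \<otimes>\<^bsub>G\<^esub> y \<otimes>\<^bsub>G\<^esub> inv\<^bsub>G\<^esub> x \<otimes>\<^bsub>G\<^esub> inv\<^bsub>G\<^esub> y"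

definition commutator_subgroup :: "('g, 'm) monoid_scheme \<Rightarrow> 'g set \<Rightarrow> 'g set \<Rightarrow> 'g set" where
  "commutator_subgroup G F H = generate G {commutator G f h | f h. f \<in> F \<and> h \<in> H}"

text \<open>
  The inductive \<^const>\<open>ideal_prod\<close> closes the products \<open>a b\<close> under addition only; for two-sided
  ideals it is the usual product ideal.
\<close>

definition sym_ideal_prod :: "('a, 'r) ring_scheme \<Rightarrow> 'a set \<Rightarrow> 'a set \<Rightarrow> 'a set" where
  "sym_ideal_prod R A B = ideal_prod R A B <+>\<^bsub>R\<^esub> ideal_prod R B A"

end

theory Submission
  imports Defs
begin

text \<open>
  Put \<open>C = AB + BA\<close>. Since \<open>t\<^sub>i\<^sub>j(a + b) = t\<^sub>i\<^sub>j(a) t\<^sub>i\<^sub>j(b)\<close> and \<open>A + B = R\<close>, the groups \<open>E(n,A)\<close> and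
  \<open>E(n,B)\<close> generate \<open>E(n,R)\<close>; hence \<open>[E(n,A),E(n,B)]\<close> is normal in \<open>E(n,R)\<close>, and it contains
  \<open>E(n,C)\<close> because \<open>t\<^sub>i\<^sub>j(ab) = [t\<^sub>i\<^sub>k(a), t\<^sub>k\<^sub>j(b)]\<close>.

  Conversely, it is enough that \<open>t\<^sub>i\<^sub>j(a)\<close> and \<open>t\<^sub>k\<^sub>l(b)\<close> commute modulo any normal subgroup \<open>N\<close> of
  \<open>E(n,R)\<close> containing \<open>E(n,C)\<close>. Only the pair \<open>t\<^sub>i\<^sub>j(a)\<close>, \<open>t\<^sub>j\<^sub>i(b)\<close> is not immediate. Write
  \<open>1 = e + f\<close> with \<open>e \<in> A\<close>, \<open>f \<in> B\<close>. As \<open>a f \<in> C\<close>, modulo \<open>N\<close> the matrix \<open>t\<^sub>i\<^sub>j(a)\<close> equals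
  \<open>t\<^sub>i\<^sub>j(a e) = [t\<^sub>i\<^sub>k(a), t\<^sub>k\<^sub>j(e)]\<close>, and both factors commute with \<open>t\<^sub>j\<^sub>i(b)\<close> modulo \<open>N\<close>.
\<close>

section \<open>Commutators in groups\<close>

context group
begin

section \<open>Commutator identities\<close>

lemma mult_inv_cancel:
  assumes "x \<in> carrier G" "y \<in> carrier G"
  shows "x \<otimes> (inv x \<otimes> y) = y" "inv x \<otimes> (x \<otimes> y) = y"
  using assms by (simp_all add: m_assoc[symmetric])

lemma commutator_closed [simp]:
  "x \<in> carrier G \<Longrightarrow> y \<in> carrier G \<Longrightarrow> commutator G x y \<in> carrier G"
  by (simp add: commutator_def)

text \<open>With \<open>z\<close> fixed, the right side is a conjugate of one commutator times
  another, so it stays in a normal subgroup containing both commutators.\<close>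

lemma commutator_mult_left:
  assumes "x \<in> carrier G" "y \<in> carrier G" "z \<in> carrier G"
  shows "commutator G (x \<otimes> y) z = x \<otimes> commutator G y z \<otimes> inv x \<otimes> commutator G x z"
  using assms by (simp add: commutator_def m_assoc inv_mult_group mult_inv_cancel)

lemma commutator_inv_left:
  assumes "x \<in> carrier G" "y \<in> carrier G"
  shows "commutator G (inv x) y = inv x \<otimes> inv (commutator G x y) \<otimes> inv (inv x)"
  using assms by (simp add: commutator_def m_assoc inv_mult_group mult_inv_cancel)

lemma inv_commutator:
  assumes "x \<in> carrier G" "y \<in> carrier G"
  shows "inv (commutator G x y) = commutator G y x"
  using assms by (simp add: commutator_def m_assoc inv_mult_group)

text \<open>For \<open>x\<close>, \<open>z\<close> in a subgroup \<open>F\<close> and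
  \<open>y\<close> in \<open>H\<close>, the right side is a generator of \<open>[F,H]\<close> times
  the inverse of another, so conjugation by \<open>F\<close> preserves \<open>[F,H]\<close>. The
  next lemma is the counterpart for conjugation by \<open>H\<close>.\<close>

lemma conj_commutator_left:
  assumes "x \<in> carrier G" "y \<in> carrier G" "z \<in> carrier G"
  shows "z \<otimes> commutator G x y \<otimes> inv z = commutator G (z \<otimes> x) y \<otimes> inv (commutator G z y)"
  using assms by (simp add: commutator_def m_assoc inv_mult_group mult_inv_cancel)

lemma conj_commutator_right:
  assumes "x \<in> carrier G" "y \<in> carrier G" "z \<in> carrier G"
  shows "z \<otimes> commutator G x y \<otimes> inv z = inv (commutator G x z) \<otimes> commutator G x (z \<otimes> y)"
  using assms by (simp add: commutator_def m_assoc inv_mult_group mult_inv_cancel)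

text \<open>Turns a commutator computation into an identity of products, so no inverse matrix has to
  be multiplied out.\<close>

lemma commutator_eqI:
  assumes "x \<in> carrier G" "y \<in> carrier G" "z \<in> carrier G" "x \<otimes> y = z \<otimes> y \<otimes> x"
  shows "commutator G x y = z"
  using assms by (simp add: commutator_def m_assoc mult_inv_cancel)

section \<open>Commuting modulo a normal subgroup\<close>

lemma normal_in_subgroupD:
  assumes "subgroup K G" "N \<lhd> G\<lparr>carrier := K\<rparr>"
  shows "subgroup N G" "N \<subseteq> K" "\<And>k x. k \<in> K \<Longrightarrow> x \<in> N \<Longrightarrow> k \<otimes> x \<otimes> inv k \<in> N"
proof -
  have grp: "group (G\<lparr>carrier := K\<rparr>)"
    using assms(1) subgroup.subgroup_is_group is_group by blast
  have N: "subgroup N (G\<lparr>carrier := K\<rparr>)"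
    "\<And>k x. k \<in> K \<Longrightarrow> x \<in> N \<Longrightarrow> k \<otimes> x \<otimes> inv\<^bsub>G\<lparr>carrier := K\<rparr>\<^esub> k \<in> N"
    using assms(2) unfolding group.normal_inv_iff[OF grp] by auto
  show "subgroup N G" "N \<subseteq> K"
    using incl_subgroup[OF assms(1) N(1)] subgroup.subset[OF N(1)] by auto
  show "\<And>k x. k \<in> K \<Longrightarrow> x \<in> N \<Longrightarrow> k \<otimes> x \<otimes> inv k \<in> N"
    using N(2) assms(1) by simp
qed

text \<open>The set is the preimage in \<open>K\<close> of the centraliser of the coset of
  \<open>s\<close> in \<open>K/N\<close>. Working with commutators in \<open>N\<close> avoids
  forming the quotient group.\<close>

lemma commuting_mod_normal_subgroup:
  assumes K: "subgroup K G" and N: "N \<lhd> G\<lparr>carrier := K\<rparr>" and s: "s \<in> K"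
  shows "subgroup {g \<in> K. commutator G g s \<in> N} G"
proof (rule subgroupI)
  note ND = normal_in_subgroupD[OF K N]
  have carr: "\<And>x. x \<in> K \<Longrightarrow> x \<in> carrier G" using subgroup.mem_carrier[OF K] .
  show "{g \<in> K. commutator G g s \<in> N} \<subseteq> carrier G" using carr by auto
  have "commutator G \<one> s = \<one>" using carr[OF s] by (simp add: commutator_def)
  then show "{g \<in> K. commutator G g s \<in> N} \<noteq> {}"
    using subgroup.one_closed[OF K] subgroup.one_closed[OF ND(1)] by auto
  fix a assume a: "a \<in> {g \<in> K. commutator G g s \<in> N}"
  then show "inv a \<in> {g \<in> K. commutator G g s \<in> N}"
    using ND(3)[of "inv a" "inv (commutator G a s)"] carr s
    by (simp add: subgroup.m_inv_closed[OF K] subgroup.m_inv_closed[OF ND(1)] commutator_inv_left)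
  fix b assume b: "b \<in> {g \<in> K. commutator G g s \<in> N}"
  show "a \<otimes> b \<in> {g \<in> K. commutator G g s \<in> N}"
    using a b carr s subgroup.m_closed[OF ND(1) ND(3)]
    by (simp add: subgroup.m_closed[OF K] commutator_mult_left)
qed

text \<open>The centraliser argument is applied twice: first with \<open>t\<close> in
  \<open>T\<close> fixed, to pass from \<open>S\<close> to \<open>generate G S\<close>, then with
  \<open>f\<close> in \<open>generate G S\<close> fixed, to pass from \<open>T\<close> to
  \<open>generate G T\<close>.\<close>

lemma commutator_subgroup_generate_incl:
  assumes K: "subgroup K G" and N: "N \<lhd> G\<lparr>carrier := K\<rparr>"
    and ST: "S \<subseteq> K" "T \<subseteq> K"
    and comm: "\<And>s t. s \<in> S \<Longrightarrow> t \<in> T \<Longrightarrow> commutator G s t \<in> N"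
  shows "commutator_subgroup G (generate G S) (generate G T) \<subseteq> N"
proof -
  note ND = normal_in_subgroupD[OF K N]
  have carr: "\<And>x. x \<in> K \<Longrightarrow> x \<in> carrier G" using subgroup.mem_carrier[OF K] .
  \<comment> \<open>The centraliser lemma varies the first argument only; inverting a commutator
    exchanges its arguments.\<close>
  have swap: "commutator G y x \<in> N" if "commutator G x y \<in> N" "x \<in> K" "y \<in> K" for x y
    using subgroup.m_inv_closed[OF ND(1) that(1)] that carr by (simp add: inv_commutator)
  have 1: "f \<in> K \<and> commutator G f t \<in> N" if "t \<in> T" "f \<in> generate G S" for f t
    using generate_subgroup_incl[OF _ commuting_mod_normal_subgroup[OF K N, of t], of S]
      that ST comm by blast
  have 2: "commutator G f h \<in> N" if f: "f \<in> generate G S" and h: "h \<in> generate G T" for f h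
  proof -
    have fK: "f \<in> K" using generate_subgroup_incl[OF ST(1) K] f by auto
    have "T \<subseteq> {g \<in> K. commutator G g f \<in> N}"
      using 1 f ST(2) swap by blast
    then have "h \<in> {g \<in> K. commutator G g f \<in> N}"
      using generate_subgroup_incl[OF _ commuting_mod_normal_subgroup[OF K N fK]] h by blast
    then show ?thesis using swap fK by blast
  qed
  show ?thesis
    unfolding commutator_subgroup_def using 2 by (intro generate_subgroup_incl ND(1)) blast
qed

section \<open>Normality of commutator subgroups\<close>

lemma conj_generate:
  assumes "subgroup H G" "S \<subseteq> carrier G" "g \<in> carrier G"
    and "\<And>x. x \<in> S \<Longrightarrow> g \<otimes> x \<otimes> inv g \<in> H" and "x \<in> generate G S"
  shows "g \<otimes> x \<otimes> inv g \<in> H"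
  using assms(5)
proof (induction rule: generate.induct)
  case one
  then show ?case using assms(3) subgroup.one_closed[OF assms(1)] by simp
next
  case (incl h)
  then show ?case by (rule assms(4))
next
  case (inv h)
  have "inv (g \<otimes> h \<otimes> inv g) = g \<otimes> inv h \<otimes> inv g"
    using inv assms(2,3) by (auto simp: inv_mult_group m_assoc)
  then show ?case using subgroup.m_inv_closed[OF assms(1) assms(4)[OF inv]] by simp
next
  case (eng h1 h2)
  have "h1 \<in> carrier G" "h2 \<in> carrier G"
    using eng generate_in_carrier[OF assms(2)] by auto
  then have "(g \<otimes> h1 \<otimes> inv g) \<otimes> (g \<otimes> h2 \<otimes> inv g) = g \<otimes> (h1 \<otimes> h2) \<otimes> inv g"
    using assms(3) by (simp add: m_assoc mult_inv_cancel)
  then show ?case using subgroup.m_closed[OF assms(1) eng.IH] by simp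
qed

lemma subgroup_commutator_subgroup:
  assumes "F \<subseteq> carrier G" "H \<subseteq> carrier G"
  shows "subgroup (commutator_subgroup G F H) G"
  unfolding commutator_subgroup_def using assms by (intro generate_is_subgroup) (auto intro!: commutator_closed)

lemma commutator_in_commutator_subgroup:
  "f \<in> F \<Longrightarrow> h \<in> H \<Longrightarrow> commutator G f h \<in> commutator_subgroup G F H"
  unfolding commutator_subgroup_def by (rule generate.incl) blast

lemma commutator_subgroup_conj:
  assumes F: "subgroup F G" and H: "subgroup H G" and z: "z \<in> F \<union> H"
    and x: "x \<in> commutator_subgroup G F H"
  shows "z \<otimes> x \<otimes> inv z \<in> commutator_subgroup G F H"
proof -
  let ?C = "commutator_subgroup G F H"
  have carr: "F \<subseteq> carrier G" "H \<subseteq> carrier G" using F H subgroup.subset by auto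
  have C: "subgroup ?C G" using subgroup_commutator_subgroup[OF carr] .
  note cl = commutator_in_commutator_subgroup subgroup.m_closed[OF C] subgroup.m_inv_closed[OF C]
  have "z \<otimes> commutator G f h \<otimes> inv z \<in> ?C" if fh: "f \<in> F" "h \<in> H" for f h
  proof (cases "z \<in> F")
    case True
    have "z \<otimes> commutator G f h \<otimes> inv z = commutator G (z \<otimes> f) h \<otimes> inv (commutator G z h)"
      using fh carr True by (intro conj_commutator_left) auto
    then show ?thesis using True fh subgroup.m_closed[OF F] by (simp add: cl)
  next
    case False
    then have zH: "z \<in> H" using z by simp
    have "z \<otimes> commutator G f h \<otimes> inv z = inv (commutator G f z) \<otimes> commutator G f (z \<otimes> h)"
      using fh carr zH by (intro conj_commutator_right) auto
    then show ?thesis using zH fh subgroup.m_closed[OF H] by (simp add: cl)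
  qed
  moreover have "{commutator G f h | f h. f \<in> F \<and> h \<in> H} \<subseteq> carrier G"
    using carr by (auto intro!: commutator_closed)
  moreover have "z \<in> carrier G" using carr z by auto
  ultimately show ?thesis
    using conj_generate[OF C] x[unfolded commutator_subgroup_def] by blast
qed

text \<open>Since \<open>S\<close> is closed under inverses, the inverse case of the induction over
  \<open>generate G S\<close> reduces to conjugation by an element of \<open>S\<close>.\<close>

lemma normal_in_generateI:
  assumes N: "subgroup N G" "N \<subseteq> generate G S" and S: "S \<subseteq> carrier G"
    and inv: "\<And>s. s \<in> S \<Longrightarrow> inv s \<in> S"
    and conj: "\<And>s x. s \<in> S \<Longrightarrow> x \<in> N \<Longrightarrow> s \<otimes> x \<otimes> inv s \<in> N"
  shows "N \<lhd> G\<lparr>carrier := generate G S\<rparr>"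
proof -
  have K: "subgroup (generate G S) G" using generate_is_subgroup[OF S] .
  have grp: "group (G\<lparr>carrier := generate G S\<rparr>)"
    using K subgroup.subgroup_is_group is_group by blast
  have "g \<otimes> x \<otimes> inv g \<in> N" if "g \<in> generate G S" "x \<in> N" for g x
    using that
  proof (induction arbitrary: x rule: generate.induct)
    case one
    then show ?case using subgroup.mem_carrier[OF N(1)] by simp
  next
    case (incl h)
    then show ?case using conj by blast
  next
    case (inv h)
    then show ?case using conj assms(4) by blast
  next
    case (eng h1 h2)
    have "h1 \<in> carrier G" "h2 \<in> carrier G" "x \<in> carrier G"
      using eng generate_in_carrier[OF S] subgroup.mem_carrier[OF N(1)] by auto
    \<comment> \<open>Conjugation by a product is done in two stages; the hypothesis for
      \<open>h1\<close> is applied to the conjugate of \<open>x\<close>, which is why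
      \<open>x\<close> is arbitrary in the induction.\<close>
    then have "h1 \<otimes> (h2 \<otimes> x \<otimes> inv h2) \<otimes> inv h1 = (h1 \<otimes> h2) \<otimes> x \<otimes> inv (h1 \<otimes> h2)"
      by (simp add: m_assoc inv_mult_group)
    moreover have "h1 \<otimes> (h2 \<otimes> x \<otimes> inv h2) \<otimes> inv h1 \<in> N"
      by (intro eng.IH eng.prems)
    ultimately show ?case by simp
  qed
  moreover have "subgroup N (G\<lparr>carrier := generate G S\<rparr>)"
    using subgroup_incl[OF N(1) K N(2)] .
  ultimately show ?thesis
    unfolding group.normal_inv_iff[OF grp] using K by simp
qed

end

section \<open>Elementary matrices\<close>

text \<open>This is where \<open>n \<ge> 3\<close> enters: a third index lets a transvection at
  \<open>(i, j)\<close> be written as a commutator through position \<open>k\<close>.\<close>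

lemma exists_third_index:
  fixes i j n :: nat
  assumes "n \<ge> 3"
  shows "\<exists>k<n. k \<noteq> i \<and> k \<noteq> j"
  using assms by presburger

context ring
begin

section \<open>Finite sums and the monoid of square matrices\<close>

lemma finsum_swap:
  fixes m n :: nat
  assumes "\<And>i j. i < m \<Longrightarrow> j < n \<Longrightarrow> f i j \<in> carrier R"
  shows "(\<Oplus>i\<in>{..<m}. \<Oplus>j\<in>{..<n}. f i j) = (\<Oplus>j\<in>{..<n}. \<Oplus>i\<in>{..<m}. f i j)"
  using assms
proof (induction m)
  case (Suc m)
  have "(\<Oplus>i\<in>{..<Suc m}. \<Oplus>j\<in>{..<n}. f i j) = (\<Oplus>j\<in>{..<n}. f m j) \<oplus> (\<Oplus>i\<in>{..<m}. \<Oplus>j\<in>{..<n}. f i j)"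
    using Suc.prems by (simp add: lessThan_Suc finsum_insert Pi_def)
  also have "\<dots> = (\<Oplus>j\<in>{..<n}. f m j \<oplus> (\<Oplus>i\<in>{..<m}. f i j))"
    using Suc by (subst finsum_addf) (auto simp: Pi_def)
  also have "\<dots> = (\<Oplus>j\<in>{..<n}. \<Oplus>i\<in>{..<Suc m}. f i j)"
    using Suc.prems by (intro finsum_cong') (auto simp: lessThan_Suc Pi_def)
  finally show ?case .
qed simp

text \<open>Evaluates the sums that arise when one factor of a matrix product is the identity or a
  transvection.\<close>

lemma finsum_delta:
  assumes "i < (n::nat)" "x \<in> carrier R"
  shows "(\<Oplus>k\<in>{..<n}. if k = i then x else \<zero>) = x"
  using add.finprod_singleton_swap[of i "{..<n}" "\<lambda>_. x"] assms by simp

lemma mat_monoid_carrierI: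
  "\<lbrakk>dim_row M = n; dim_col M = n; \<And>i j. i < n \<Longrightarrow> j < n \<Longrightarrow> M $$ (i, j) \<in> carrier R\<rbrakk>
   \<Longrightarrow> M \<in> carrier (mat_monoid n R)"
  by (auto simp: mat_monoid_def)

lemma mat_monoid_carrierD:
  assumes "M \<in> carrier (mat_monoid n R)"
  shows "dim_row M = n" "dim_col M = n" "\<And>i j. i < n \<Longrightarrow> j < n \<Longrightarrow> M $$ (i, j) \<in> carrier R"
  using assms by (auto simp: mat_monoid_def)

lemma mat_monoid_mult:
  "M \<otimes>\<^bsub>mat_monoid n R\<^esub> N = mat n n (\<lambda>(i, j). \<Oplus>k\<in>{..<n}. M $$ (i, k) \<otimes> N $$ (k, j))"
  by (simp add: mat_monoid_def)

lemma mat_monoid_one: "\<one>\<^bsub>mat_monoid n R\<^esub> = mat n n (\<lambda>(i, j). if i = j then \<one> else \<zero>)"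
  by (simp add: mat_monoid_def)

lemma monoid_mat_monoid: "monoid (mat_monoid n R)"
proof (rule monoidI)
  fix L M N
  assume "L \<in> carrier (mat_monoid n R)" "M \<in> carrier (mat_monoid n R)" "N \<in> carrier (mat_monoid n R)"
  note LMN = this[THEN mat_monoid_carrierD(3)]
  show "L \<otimes>\<^bsub>mat_monoid n R\<^esub> M \<in> carrier (mat_monoid n R)"
    using LMN by (auto intro!: mat_monoid_carrierI finsum_closed simp: mat_monoid_mult)
  show "L \<otimes>\<^bsub>mat_monoid n R\<^esub> M \<otimes>\<^bsub>mat_monoid n R\<^esub> N
      = L \<otimes>\<^bsub>mat_monoid n R\<^esub> (M \<otimes>\<^bsub>mat_monoid n R\<^esub> N)"
  proof (rule eq_matI)
    fix i j
    assume "i < dim_row (L \<otimes>\<^bsub>mat_monoid n R\<^esub> (M \<otimes>\<^bsub>mat_monoid n R\<^esub> N))"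
      "j < dim_col (L \<otimes>\<^bsub>mat_monoid n R\<^esub> (M \<otimes>\<^bsub>mat_monoid n R\<^esub> N))"
    then have ij: "i < n" "j < n" by (auto simp: mat_monoid_mult)
    \<comment> \<open>Expand to a double sum, interchange the sums, and factor again. The order of
      the three ring factors never changes, as \<open>R\<close> may be noncommutative.\<close>
    have "(L \<otimes>\<^bsub>mat_monoid n R\<^esub> M \<otimes>\<^bsub>mat_monoid n R\<^esub> N) $$ (i, j)
        = (\<Oplus>k\<in>{..<n}. (\<Oplus>l\<in>{..<n}. L $$ (i, l) \<otimes> M $$ (l, k)) \<otimes> N $$ (k, j))"
      using ij LMN by (auto intro!: finsum_cong' finsum_closed simp: mat_monoid_mult)
    also have "\<dots> = (\<Oplus>k\<in>{..<n}. \<Oplus>l\<in>{..<n}. L $$ (i, l) \<otimes> M $$ (l, k) \<otimes> N $$ (k, j))"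
      using ij LMN by (intro finsum_cong') (auto intro!: finsum_ldistr finsum_closed)
    also have "\<dots> = (\<Oplus>l\<in>{..<n}. \<Oplus>k\<in>{..<n}. L $$ (i, l) \<otimes> M $$ (l, k) \<otimes> N $$ (k, j))"
      using ij LMN by (intro finsum_swap) auto
    also have "\<dots> = (\<Oplus>l\<in>{..<n}. \<Oplus>k\<in>{..<n}. L $$ (i, l) \<otimes> (M $$ (l, k) \<otimes> N $$ (k, j)))"
      using ij LMN by (intro finsum_cong') (auto intro!: finsum_cong' finsum_closed simp: m_assoc)
    also have "\<dots> = (\<Oplus>l\<in>{..<n}. L $$ (i, l) \<otimes> (\<Oplus>k\<in>{..<n}. M $$ (l, k) \<otimes> N $$ (k, j)))"
      using ij LMN by (intro finsum_cong') (auto intro!: finsum_rdistr[symmetric] finsum_closed)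
    also have "\<dots> = (L \<otimes>\<^bsub>mat_monoid n R\<^esub> (M \<otimes>\<^bsub>mat_monoid n R\<^esub> N)) $$ (i, j)"
      using ij LMN by (auto intro!: finsum_cong' finsum_closed simp: mat_monoid_mult)
    finally show "(L \<otimes>\<^bsub>mat_monoid n R\<^esub> M \<otimes>\<^bsub>mat_monoid n R\<^esub> N) $$ (i, j)
        = (L \<otimes>\<^bsub>mat_monoid n R\<^esub> (M \<otimes>\<^bsub>mat_monoid n R\<^esub> N)) $$ (i, j)" .
  qed (auto simp: mat_monoid_mult)
next
  show "\<one>\<^bsub>mat_monoid n R\<^esub> \<in> carrier (mat_monoid n R)"
    by (auto intro!: mat_monoid_carrierI simp: mat_monoid_one)
  fix M assume M: "M \<in> carrier (mat_monoid n R)"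
  note MD = mat_monoid_carrierD[OF M]
  show "\<one>\<^bsub>mat_monoid n R\<^esub> \<otimes>\<^bsub>mat_monoid n R\<^esub> M = M"
  proof (rule eq_matI)
    fix i j assume "i < dim_row M" "j < dim_col M"
    then have ij: "i < n" "j < n" using MD by auto
    have "(\<one>\<^bsub>mat_monoid n R\<^esub> \<otimes>\<^bsub>mat_monoid n R\<^esub> M) $$ (i, j)
        = (\<Oplus>k\<in>{..<n}. if k = i then M $$ (i, j) else \<zero>)"
      using ij MD by (auto intro!: finsum_cong' simp: mat_monoid_mult mat_monoid_one)
    then show "(\<one>\<^bsub>mat_monoid n R\<^esub> \<otimes>\<^bsub>mat_monoid n R\<^esub> M) $$ (i, j) = M $$ (i, j)"
      using ij MD by (simp add: finsum_delta)
  qed (use MD in \<open>auto simp: mat_monoid_mult\<close>)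
  show "M \<otimes>\<^bsub>mat_monoid n R\<^esub> \<one>\<^bsub>mat_monoid n R\<^esub> = M"
  proof (rule eq_matI)
    fix i j assume "i < dim_row M" "j < dim_col M"
    then have ij: "i < n" "j < n" using MD by auto
    have "(M \<otimes>\<^bsub>mat_monoid n R\<^esub> \<one>\<^bsub>mat_monoid n R\<^esub>) $$ (i, j)
        = (\<Oplus>k\<in>{..<n}. if k = j then M $$ (i, j) else \<zero>)"
      using ij MD by (auto intro!: finsum_cong' simp: mat_monoid_mult mat_monoid_one)
    then show "(M \<otimes>\<^bsub>mat_monoid n R\<^esub> \<one>\<^bsub>mat_monoid n R\<^esub>) $$ (i, j) = M $$ (i, j)"
      using ij MD by (simp add: finsum_delta)
  qed (use MD in \<open>auto simp: mat_monoid_mult\<close>)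
qed

lemma group_GL: "group (GL n R)"
  unfolding GL_def by (rule monoid.units_group[OF monoid_mat_monoid])

lemma GL_mult: "M \<otimes>\<^bsub>GL n R\<^esub> N = M \<otimes>\<^bsub>mat_monoid n R\<^esub> N"
  and GL_one: "\<one>\<^bsub>GL n R\<^esub> = \<one>\<^bsub>mat_monoid n R\<^esub>"
  by (simp_all add: GL_def units_of_mult units_of_one)

section \<open>Transvections and their commutator relations\<close>

lemma transvection_dim [simp]:
  "dim_row (transvection n R i j c) = n" "dim_col (transvection n R i j c) = n"
  by (simp_all add: transvection_def)

text \<open>As \<open>i \<noteq> j\<close>, the entry \<open>c\<close> never meets the diagonal, so
  the sum in the definition becomes a plain case distinction.\<close>

lemma transvection_index:
  assumes "k < n" "l < n" "i \<noteq> j" "c \<in> carrier R"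
  shows "transvection n R i j c $$ (k, l) =
    (if k = l then \<one> else if k = i \<and> l = j then c else \<zero>)"
  using assms by (auto simp: transvection_def)

lemma transvection_in_mat_monoid:
  "i \<noteq> j \<Longrightarrow> c \<in> carrier R \<Longrightarrow> transvection n R i j c \<in> carrier (mat_monoid n R)"
  by (rule mat_monoid_carrierI) (simp_all add: transvection_index)

text \<open>Left multiplication by a transvection is a row operation: \<open>c\<close> times row
  \<open>j\<close> is added to row \<open>i\<close>. The identities between transvections below are
  computed with this formula.\<close>

lemma transvection_mult_index:
  assumes "i < n" "j < n" "i \<noteq> j" "c \<in> carrier R" "M \<in> carrier (mat_monoid n R)" "k < n" "l < n"
  shows "(transvection n R i j c \<otimes>\<^bsub>mat_monoid n R\<^esub> M) $$ (k, l) =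
    (if k = i then M $$ (i, l) \<oplus> c \<otimes> M $$ (j, l) else M $$ (k, l))"
proof -
  note M = mat_monoid_carrierD[OF assms(5)]
  \<comment> \<open>Row \<open>k\<close> of the transvection is nonzero at most at the diagonal and,
    if \<open>k = i\<close>, at column \<open>j\<close>; the sum splits into two sums with one term
    each.\<close>
  have "(\<Oplus>m\<in>{..<n}. transvection n R i j c $$ (k, m) \<otimes> M $$ (m, l))
      = (\<Oplus>m\<in>{..<n}. (if m = k then M $$ (k, l) else \<zero>)
            \<oplus> (if m = j then (if k = i then c \<otimes> M $$ (j, l) else \<zero>) else \<zero>))"
    using assms M by (intro finsum_cong') (auto simp: transvection_index)
  also have "\<dots> = M $$ (k, l) \<oplus> (if k = i then c \<otimes> M $$ (j, l) else \<zero>)"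
    using assms M by (subst finsum_addf) (auto simp: finsum_delta)
  finally show ?thesis
    using assms M by (simp add: mat_monoid_mult)
qed

lemma transvection_zero: "i \<noteq> j \<Longrightarrow> transvection n R i j \<zero> = \<one>\<^bsub>mat_monoid n R\<^esub>"
  by (rule eq_matI) (auto simp: transvection_index mat_monoid_one)

lemma transvection_add_mat_monoid:
  assumes "i < n" "j < n" "i \<noteq> j" "a \<in> carrier R" "b \<in> carrier R"
  shows "transvection n R i j a \<otimes>\<^bsub>mat_monoid n R\<^esub> transvection n R i j b
    = transvection n R i j (a \<oplus> b)"
proof (rule eq_matI)
  fix k l assume "k < dim_row (transvection n R i j (a \<oplus> b))" "l < dim_col (transvection n R i j (a \<oplus> b))"
  then have "k < n" "l < n" by simp_all
  \<comment> \<open>At position \<open>(i, j)\<close> the row operation yields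
    \<open>b \<oplus> a\<close>, hence the use of \<open>a_comm\<close>.\<close>
  then show "(transvection n R i j a \<otimes>\<^bsub>mat_monoid n R\<^esub> transvection n R i j b) $$ (k, l)
      = transvection n R i j (a \<oplus> b) $$ (k, l)"
    using assms
    by (simp add: transvection_mult_index transvection_in_mat_monoid) (auto simp: transvection_index a_comm)
qed (simp_all add: mat_monoid_mult)

lemma transvection_in_GL:
  assumes "i < n" "j < n" "i \<noteq> j" "c \<in> carrier R"
  shows "transvection n R i j c \<in> carrier (GL n R)"
proof -
  have "transvection n R i j c \<otimes>\<^bsub>mat_monoid n R\<^esub> transvection n R i j (\<ominus> c) = \<one>\<^bsub>mat_monoid n R\<^esub>"
    "transvection n R i j (\<ominus> c) \<otimes>\<^bsub>mat_monoid n R\<^esub> transvection n R i j c = \<one>\<^bsub>mat_monoid n R\<^esub>"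
    using assms by (simp_all add: transvection_add_mat_monoid r_neg l_neg transvection_zero)
  then show ?thesis
    using assms transvection_in_mat_monoid[of i j] unfolding GL_def units_of_carrier Units_def
    by (auto intro!: bexI[of _ "transvection n R i j (\<ominus> c)"])
qed

lemma transvection_add:
  assumes "i < n" "j < n" "i \<noteq> j" "a \<in> carrier R" "b \<in> carrier R"
  shows "transvection n R i j (a \<oplus> b) = transvection n R i j a \<otimes>\<^bsub>GL n R\<^esub> transvection n R i j b"
  using assms by (simp add: GL_mult transvection_add_mat_monoid)

lemma inv_transvection:
  assumes "i < n" "j < n" "i \<noteq> j" "c \<in> carrier R"
  shows "inv\<^bsub>GL n R\<^esub> transvection n R i j c = transvection n R i j (\<ominus> c)"
  using assms
  by (intro group.inv_equality[OF group_GL])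
    (simp_all add: transvection_in_GL transvection_add[symmetric] l_neg transvection_zero GL_one)

text \<open>The Steinberg relation for linked positions, checked entry by entry in the form
  \<open>x y = z (y x)\<close>. With this bracketing every left factor is a transvection, so row
  operations suffice.\<close>

lemma commutator_transvection:
  assumes "i < n" "j < n" "k < n" "i \<noteq> j" "j \<noteq> k" "i \<noteq> k" "a \<in> carrier R" "b \<in> carrier R"
  shows "commutator (GL n R) (transvection n R i j a) (transvection n R j k b)
    = transvection n R i k (a \<otimes> b)"
proof (rule group.commutator_eqI[OF group_GL])
  let ?x = "transvection n R i j a" and ?y = "transvection n R j k b"
  let ?z = "transvection n R i k (a \<otimes> b)"
  have carr: "?y \<otimes>\<^bsub>mat_monoid n R\<^esub> ?x \<in> carrier (mat_monoid n R)"
    using assms by (simp add: monoid.m_closed[OF monoid_mat_monoid] transvection_in_mat_monoid)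
  have "?x \<otimes>\<^bsub>mat_monoid n R\<^esub> ?y = ?z \<otimes>\<^bsub>mat_monoid n R\<^esub> (?y \<otimes>\<^bsub>mat_monoid n R\<^esub> ?x)"
  proof (rule eq_matI)
    fix p q
    assume "p < dim_row (?z \<otimes>\<^bsub>mat_monoid n R\<^esub> (?y \<otimes>\<^bsub>mat_monoid n R\<^esub> ?x))"
      "q < dim_col (?z \<otimes>\<^bsub>mat_monoid n R\<^esub> (?y \<otimes>\<^bsub>mat_monoid n R\<^esub> ?x))"
    then have "p < n" "q < n" by (simp_all add: mat_monoid_mult)
    then show "(?x \<otimes>\<^bsub>mat_monoid n R\<^esub> ?y) $$ (p, q)
        = (?z \<otimes>\<^bsub>mat_monoid n R\<^esub> (?y \<otimes>\<^bsub>mat_monoid n R\<^esub> ?x)) $$ (p, q)"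
      using assms carr
      by (cases "p = i"; cases "p = j"; cases "q = i"; cases "q = j"; cases "q = k")
        (simp_all add: transvection_mult_index transvection_in_mat_monoid transvection_index)
  qed (simp_all add: mat_monoid_mult)
  then show "?x \<otimes>\<^bsub>GL n R\<^esub> ?y = ?z \<otimes>\<^bsub>GL n R\<^esub> ?y \<otimes>\<^bsub>GL n R\<^esub> ?x"
    using assms by (simp add: GL_mult monoid.m_assoc[OF monoid_mat_monoid] transvection_in_mat_monoid)
qed (use assms in \<open>simp_all add: transvection_in_GL\<close>)

text \<open>Since \<open>j \<noteq> k\<close> and \<open>i \<noteq> l\<close>, the matrix units at
  \<open>(i, j)\<close> and \<open>(k, l)\<close> multiply to zero in both orders, so both products
  are the identity plus the two off-diagonal terms.\<close>

lemma commutator_transvection_trivial: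
  assumes "i < n" "j < n" "i \<noteq> j" "k < n" "l < n" "k \<noteq> l" "j \<noteq> k" "i \<noteq> l"
    and "a \<in> carrier R" "b \<in> carrier R"
  shows "commutator (GL n R) (transvection n R i j a) (transvection n R k l b) = \<one>\<^bsub>GL n R\<^esub>"
proof (rule group.commutator_eqI[OF group_GL])
  let ?x = "transvection n R i j a" and ?y = "transvection n R k l b"
  have "?x \<otimes>\<^bsub>mat_monoid n R\<^esub> ?y = ?y \<otimes>\<^bsub>mat_monoid n R\<^esub> ?x"
  proof (rule eq_matI)
    fix p q
    assume "p < dim_row (?y \<otimes>\<^bsub>mat_monoid n R\<^esub> ?x)" "q < dim_col (?y \<otimes>\<^bsub>mat_monoid n R\<^esub> ?x)"
    then have "p < n" "q < n" by (simp_all add: mat_monoid_mult)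
    then show "(?x \<otimes>\<^bsub>mat_monoid n R\<^esub> ?y) $$ (p, q) = (?y \<otimes>\<^bsub>mat_monoid n R\<^esub> ?x) $$ (p, q)"
      using assms
      by (cases "p = i"; cases "p = k"; cases "q = j"; cases "q = l")
        (simp_all add: transvection_mult_index transvection_in_mat_monoid transvection_index a_comm)
  qed (simp_all add: mat_monoid_mult)
  then show "?x \<otimes>\<^bsub>GL n R\<^esub> ?y = \<one>\<^bsub>GL n R\<^esub> \<otimes>\<^bsub>GL n R\<^esub> ?y \<otimes>\<^bsub>GL n R\<^esub> ?x"
    using assms group.is_monoid[OF group_GL]
    by (simp add: monoid.l_one transvection_in_GL) (simp add: GL_mult)
qed (use assms in \<open>simp_all add: transvection_in_GL monoid.one_closed[OF group.is_monoid[OF group_GL]]\<close>)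

section \<open>Elementary subgroups and product ideals\<close>

lemma transvections_subset_GL:
  assumes "A \<subseteq> carrier R"
  shows "{transvection n R i j a | i j a. i < n \<and> j < n \<and> i \<noteq> j \<and> a \<in> A} \<subseteq> carrier (GL n R)"
  using assms transvection_in_GL by blast

lemma subgroup_elementary:
  "A \<subseteq> carrier R \<Longrightarrow> subgroup (elementary n R A) (GL n R)"
  unfolding elementary_def
  by (rule group.generate_is_subgroup[OF group_GL transvections_subset_GL])

lemma transvection_in_elementary:
  "\<lbrakk>i < n; j < n; i \<noteq> j; a \<in> A\<rbrakk> \<Longrightarrow> transvection n R i j a \<in> elementary n R A"
  unfolding elementary_def by (rule generate.incl) blast

lemma elementary_subset:
  assumes "subgroup H (GL n R)"
    and "\<And>i j a. \<lbrakk>i < n; j < n; i \<noteq> j; a \<in> A\<rbrakk> \<Longrightarrow> transvection n R i j a \<in> H"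
  shows "elementary n R A \<subseteq> H"
  unfolding elementary_def
  using assms(2) by (intro group.generate_subgroup_incl[OF group_GL _ assms(1)]) blast

text \<open>Transvections at a fixed position turn sums into products, so it is enough to treat the
  products \<open>a \<otimes> b\<close>. Membership in the carrier is carried through the induction
  because additivity needs it.\<close>

lemma transvection_ideal_prod:
  assumes H: "subgroup H (GL n R)" and "I \<subseteq> carrier R" "J \<subseteq> carrier R"
    and ij: "i < n" "j < n" "i \<noteq> j"
    and prod: "\<And>a b. a \<in> I \<Longrightarrow> b \<in> J \<Longrightarrow> transvection n R i j (a \<otimes> b) \<in> H"
    and c: "c \<in> ideal_prod R I J"
  shows "c \<in> carrier R \<and> transvection n R i j c \<in> H"
  using c
proof (induction rule: ideal_prod.induct)
  case (prod a b)
  then show ?case using assms(2,3) assms(7) by blast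
next
  case (sum s t)
  then show ?case using ij by (simp add: transvection_add subgroup.m_closed[OF H])
qed

lemma mem_sym_ideal_prod:
  assumes "ideal A R" "ideal B R" "a \<in> A" "b \<in> B"
  shows "a \<otimes> b \<in> sym_ideal_prod R A B" "b \<otimes> a \<in> sym_ideal_prod R A B"
proof -
  note I = ideal_prod_is_ideal[OF assms(1,2)] ideal_prod_is_ideal[OF assms(2,1)]
  \<comment> \<open>The sum of the two product ideals is the ideal generated by their union.\<close>
  have "ideal_prod R A B \<subseteq> sym_ideal_prod R A B" "ideal_prod R B A \<subseteq> sym_ideal_prod R A B"
    unfolding sym_ideal_prod_def
    using union_genideal[OF I] genideal_self[of "ideal_prod R A B \<union> ideal_prod R B A"]
      ideal.Icarr[OF I(1)] ideal.Icarr[OF I(2)] by auto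
  then show "a \<otimes> b \<in> sym_ideal_prod R A B" "b \<otimes> a \<in> sym_ideal_prod R A B"
    using assms(3,4) ideal_prod.prod by (metis subsetD)+
qed

end

section \<open>The two inclusions\<close>

context ring
begin

lemma ideal_subset: "ideal I R \<Longrightarrow> I \<subseteq> carrier R"
  by (rule additive_subgroup.a_subset[OF ideal.axioms(1)])

lemma elementary_sym_ideal_prod_subset:
  assumes n: "n \<ge> 3" and A: "ideal A R" and B: "ideal B R"
  shows "elementary n R (sym_ideal_prod R A B)
    \<subseteq> commutator_subgroup (GL n R) (elementary n R A) (elementary n R B)"
    (is "_ \<subseteq> ?H")
proof -
  note sub = ideal_subset[OF A] ideal_subset[OF B]
  have E: "subgroup (elementary n R A) (GL n R)" "subgroup (elementary n R B) (GL n R)"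
    using sub subgroup_elementary by auto
  have H: "subgroup ?H (GL n R)"
    using E by (intro group.subgroup_commutator_subgroup[OF group_GL] subgroup.subset)
  have "transvection n R i j c \<in> ?H"
    if ij: "i < n" "j < n" "i \<noteq> j" and c: "c \<in> sym_ideal_prod R A B" for i j c
  proof -
    obtain k where k: "k < n" "k \<noteq> i" "k \<noteq> j" using exists_third_index[OF n] by blast
    have AB: "transvection n R i j (a \<otimes> b) \<in> ?H" if "a \<in> A" "b \<in> B" for a b
    proof -
      have "transvection n R i j (a \<otimes> b)
          = commutator (GL n R) (transvection n R i k a) (transvection n R k j b)"
        using ij k that sub by (intro commutator_transvection[symmetric]) auto
      then show ?thesis
        using ij k that
        by (simp add: group.commutator_in_commutator_subgroup[OF group_GL] transvection_in_elementary)
    qed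
    \<comment> \<open>Here the factor of level \<open>B\<close> comes first, so the commutator is
      the inverse of a generator of \<open>?H\<close>.\<close>
    have BA: "transvection n R i j (b \<otimes> a) \<in> ?H" if "b \<in> B" "a \<in> A" for a b
    proof -
      have "transvection n R i j (b \<otimes> a)
          = commutator (GL n R) (transvection n R i k b) (transvection n R k j a)"
        using ij k that sub by (intro commutator_transvection[symmetric]) auto
      also have "\<dots> = inv\<^bsub>GL n R\<^esub> commutator (GL n R) (transvection n R k j a) (transvection n R i k b)"
        using ij k that sub
        by (intro group.inv_commutator[OF group_GL, symmetric] transvection_in_GL) auto
      finally show ?thesis
        using ij k that
        by (simp add: group.commutator_in_commutator_subgroup[OF group_GL] transvection_in_elementary
            subgroup.m_inv_closed[OF H])
    qed
    obtain c1 c2 where "c1 \<in> ideal_prod R A B" "c2 \<in> ideal_prod R B A" and c12: "c = c1 \<oplus> c2"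
      using c unfolding sym_ideal_prod_def set_add_def' by auto
    then have "c1 \<in> carrier R \<and> transvection n R i j c1 \<in> ?H"
      "c2 \<in> carrier R \<and> transvection n R i j c2 \<in> ?H"
      using transvection_ideal_prod[OF H sub ij AB] transvection_ideal_prod[OF H sub(2,1) ij BA]
      by blast+
    then show ?thesis
      using ij by (simp add: c12 transvection_add subgroup.m_closed[OF H])
  qed
  then show ?thesis by (intro elementary_subset[OF H])
qed

lemma commutator_subgroup_normal:
  assumes A: "ideal A R" and B: "ideal B R" and AB: "A <+>\<^bsub>R\<^esub> B = carrier R"
  shows "commutator_subgroup (GL n R) (elementary n R A) (elementary n R B)
    \<lhd> (GL n R)\<lparr>carrier := elementary n R (carrier R)\<rparr>"
    (is "?H \<lhd> _")
proof -
  interpret GL: group "GL n R" by (rule group_GL)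
  let ?T = "{transvection n R i j a | i j a. i < n \<and> j < n \<and> i \<noteq> j \<and> a \<in> carrier R}"
  note sub = ideal_subset[OF A] ideal_subset[OF B]
  have E: "subgroup (elementary n R A) (GL n R)" "subgroup (elementary n R B) (GL n R)"
    using sub subgroup_elementary by auto
  have ER: "subgroup (elementary n R (carrier R)) (GL n R)"
    by (rule subgroup_elementary) simp
  have H: "subgroup ?H (GL n R)"
    using E by (intro GL.subgroup_commutator_subgroup subgroup.subset)
  have EAB: "elementary n R A \<subseteq> elementary n R (carrier R)" "elementary n R B \<subseteq> elementary n R (carrier R)"
    using sub by (intro elementary_subset[OF ER] transvection_in_elementary; blast)+
  have "?H \<subseteq> elementary n R (carrier R)"
    unfolding commutator_subgroup_def
  proof (intro GL.generate_subgroup_incl[OF _ ER] subsetI)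
    fix x assume "x \<in> {commutator (GL n R) f h | f h. f \<in> elementary n R A \<and> h \<in> elementary n R B}"
    then obtain f h where "x = commutator (GL n R) f h"
      and "f \<in> elementary n R (carrier R)" "h \<in> elementary n R (carrier R)"
      using EAB by blast
    then show "x \<in> elementary n R (carrier R)"
      by (simp add: commutator_def subgroup.m_closed[OF ER] subgroup.m_inv_closed[OF ER])
  qed
  moreover have "s \<otimes>\<^bsub>GL n R\<^esub> x \<otimes>\<^bsub>GL n R\<^esub> inv\<^bsub>GL n R\<^esub> s \<in> ?H" if s: "s \<in> ?T" and x: "x \<in> ?H" for s x
  proof -
    obtain i j r where ij: "i < n" "j < n" "i \<noteq> j" and r: "r \<in> carrier R" "s = transvection n R i j r"
      using s by blast
    \<comment> \<open>Comaximality splits each generator of \<open>E(n,R)\<close> into a factor from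
      \<open>E(n,A)\<close> and one from \<open>E(n,B)\<close>; each of them normalises
      \<open>?H\<close>.\<close>
    obtain a b where ab: "a \<in> A" "b \<in> B" "r = a \<oplus> b"
      using r(1) unfolding AB[symmetric] set_add_def' by auto
    let ?x = "transvection n R i j a" and ?y = "transvection n R i j b"
    have "a \<in> carrier R" "b \<in> carrier R" using ab sub by auto
    then have "s = ?x \<otimes>\<^bsub>GL n R\<^esub> ?y" using ab r(2) ij by (simp add: transvection_add)
    moreover have "?x \<in> carrier (GL n R)" "?y \<in> carrier (GL n R)" "x \<in> carrier (GL n R)"
      using ab ij sub subgroup.mem_carrier[OF H x] by (auto simp: transvection_in_GL)
    ultimately have "s \<otimes>\<^bsub>GL n R\<^esub> x \<otimes>\<^bsub>GL n R\<^esub> inv\<^bsub>GL n R\<^esub> s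
        = ?x \<otimes>\<^bsub>GL n R\<^esub> (?y \<otimes>\<^bsub>GL n R\<^esub> x \<otimes>\<^bsub>GL n R\<^esub> inv\<^bsub>GL n R\<^esub> ?y) \<otimes>\<^bsub>GL n R\<^esub> inv\<^bsub>GL n R\<^esub> ?x"
      by (simp add: GL.m_assoc GL.inv_mult_group)
    then show ?thesis
      using ab ij x by (simp add: GL.commutator_subgroup_conj[OF E] transvection_in_elementary)
  qed
  moreover have "inv\<^bsub>GL n R\<^esub> s \<in> ?T" if s: "s \<in> ?T" for s
  proof -
    obtain i j r where "i < n" "j < n" "i \<noteq> j" "r \<in> carrier R" "s = transvection n R i j r"
      using s by blast
    moreover from this have "inv\<^bsub>GL n R\<^esub> s = transvection n R i j (\<ominus> r)" "\<ominus> r \<in> carrier R"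
      by (simp_all add: inv_transvection)
    ultimately show ?thesis by blast
  qed
  ultimately show ?thesis
    unfolding elementary_def[of n R "carrier R"]
    by (intro GL.normal_in_generateI H transvections_subset_GL subset_refl)
qed

text \<open>As \<open>N\<close> is arbitrary, the inclusion passes to the intersection defining
  \<open>normal_closure\<close>, without first proving that intersection normal.\<close>

lemma commutator_subgroup_elementary_subset:
  assumes n: "n \<ge> 3" and A: "ideal A R" and B: "ideal B R" and AB: "A <+>\<^bsub>R\<^esub> B = carrier R"
    and N: "N \<lhd> (GL n R)\<lparr>carrier := elementary n R (carrier R)\<rparr>"
    and C: "elementary n R (sym_ideal_prod R A B) \<subseteq> N"
  shows "commutator_subgroup (GL n R) (elementary n R A) (elementary n R B) \<subseteq> N"
proof -
  interpret GL: group "GL n R" by (rule group_GL)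
  note sub = ideal_subset[OF A] ideal_subset[OF B]
  let ?t = "transvection n R" and ?E = "elementary n R (carrier R)"
  let ?comm = "commutator (GL n R)"
  have E: "subgroup ?E (GL n R)"
    by (rule subgroup_elementary) simp
  note ND = GL.normal_in_subgroupD[OF E N]
  have tN: "?t i j (a \<otimes> b) \<in> N" "?t i j (b \<otimes> a) \<in> N"
    if "i < n" "j < n" "i \<noteq> j" "a \<in> A" "b \<in> B" for i j a b
    using that C mem_sym_ideal_prod[OF A B] transvection_in_elementary[of i n j] by auto
  have generic: "?comm (?t i j a) (?t k l b) \<in> N"
    if ij: "i < n" "j < n" "i \<noteq> j" and kl: "k < n" "l < n" "k \<noteq> l" and ab: "a \<in> A" "b \<in> B"
      and nonopp: "i \<noteq> l \<or> j \<noteq> k" for i j k l a b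
  proof -
    have carr: "a \<in> carrier R" "b \<in> carrier R" using ab sub by auto
    \<comment> \<open>Linked positions give a transvection with entry in \<open>AB\<close>, or the
      inverse of one with entry in \<open>BA\<close>; unlinked positions give the identity.\<close>
    consider "j = k" "i \<noteq> l" | "i = l" "j \<noteq> k" | "j \<noteq> k" "i \<noteq> l" using nonopp by blast
    then show ?thesis
    proof cases
      case 1
      then show ?thesis using ij kl carr ab by (simp add: commutator_transvection tN)
    next
      case 2
      have "?comm (?t i j a) (?t k l b) = inv\<^bsub>GL n R\<^esub> ?comm (?t k l b) (?t i j a)"
        using ij kl carr by (simp add: GL.inv_commutator transvection_in_GL)
      also have "?comm (?t k l b) (?t i j a) = ?t k j (b \<otimes> a)"
        using 2 ij kl carr by (simp add: commutator_transvection)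
      finally show ?thesis using 2 ij kl ab by (simp add: tN subgroup.m_inv_closed[OF ND(1)])
    next
      case 3
      then show ?thesis
        using ij kl carr by (simp add: commutator_transvection_trivial subgroup.one_closed[OF ND(1)])
    qed
  qed
  obtain e f where ef: "e \<in> A" "f \<in> B" "\<one> = e \<oplus> f"
    using one_closed unfolding AB[symmetric] set_add_def' by auto
  have opposite: "?comm (?t i j a) (?t j i b) \<in> N"
    if ij: "i < n" "j < n" "i \<noteq> j" and ab: "a \<in> A" "b \<in> B" for i j a b
  proof -
    obtain k where k: "k < n" "k \<noteq> i" "k \<noteq> j" using exists_third_index[OF n] by blast
    have carr: "a \<in> carrier R" "b \<in> carrier R" "e \<in> carrier R" "f \<in> carrier R" using ab ef sub by auto
    let ?Z = "{g \<in> ?E. ?comm g (?t j i b) \<in> N}"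
    have Z: "subgroup ?Z (GL n R)"
      using ij carr by (intro GL.commuting_mod_normal_subgroup[OF E N] transvection_in_elementary) auto
    \<comment> \<open>Neither \<open>(i, k)\<close> nor \<open>(k, j)\<close> is opposite to
      \<open>(j, i)\<close>, and \<open>e\<close> lies in \<open>A\<close>, so
      \<open>generic\<close> covers both.\<close>
    have "?t i k a \<in> ?Z" "?t k j e \<in> ?Z"
      using ij k carr ab ef by (simp_all add: generic transvection_in_elementary)
    then have "?comm (?t i k a) (?t k j e) \<in> ?Z"
      unfolding commutator_def[of "GL n R" "?t i k a"]
      by (intro subgroup.m_closed[OF Z] subgroup.m_inv_closed[OF Z])
    then have 1: "?t i j (a \<otimes> e) \<in> ?Z"
      using ij k carr by (simp add: commutator_transvection)
    have x: "?t i j (a \<otimes> f) \<in> N" using ij ab ef by (simp add: tN)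
    \<comment> \<open>Bracketed so that the commutator is an element of \<open>N\<close> times a
      conjugate of its inverse.\<close>
    have "?comm (?t i j (a \<otimes> f)) (?t j i b) =
        ?t i j (a \<otimes> f) \<otimes>\<^bsub>GL n R\<^esub> (?t j i b \<otimes>\<^bsub>GL n R\<^esub> inv\<^bsub>GL n R\<^esub> ?t i j (a \<otimes> f) \<otimes>\<^bsub>GL n R\<^esub> inv\<^bsub>GL n R\<^esub> ?t j i b)"
      using ij carr by (simp add: commutator_def GL.m_assoc transvection_in_GL)
    also have "\<dots> \<in> N"
      using ij carr by (intro subgroup.m_closed[OF ND(1)] x ND(3) subgroup.m_inv_closed[OF ND(1)]
          transvection_in_elementary) auto
    finally have 2: "?t i j (a \<otimes> f) \<in> ?Z" using x ND(2) by blast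
    have "a = a \<otimes> e \<oplus> a \<otimes> f" using carr ef(3) by (metis r_distr r_one)
    then have "?t i j a = ?t i j (a \<otimes> e) \<otimes>\<^bsub>GL n R\<^esub> ?t i j (a \<otimes> f)"
      using ij carr by (metis transvection_add m_closed)
    then show ?thesis using subgroup.m_closed[OF Z 1 2] by simp
  qed
  show ?thesis
    unfolding elementary_def[of n R A] elementary_def[of n R B]
  proof (rule GL.commutator_subgroup_generate_incl[OF E N])
    fix s t
    assume "s \<in> {?t i j a | i j a. i < n \<and> j < n \<and> i \<noteq> j \<and> a \<in> A}"
      and "t \<in> {?t i j a | i j a. i < n \<and> j < n \<and> i \<noteq> j \<and> a \<in> B}"
    then show "?comm s t \<in> N" using generic opposite by blast
  qed (use sub in \<open>auto intro!: transvection_in_elementary\<close>)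
qed

end

theorem theorem2:
  fixes R :: "('a, 'r) ring_scheme" and n :: nat and A B :: "'a set"
  assumes "ring R"
    and "n \<ge> 3"
    and "ideal A R"
    and "ideal B R"
    and "A <+>\<^bsub>R\<^esub> B = carrier R"
  shows "commutator_subgroup (GL n R) (elementary n R A) (elementary n R B)
       = rel_elementary n R (sym_ideal_prod R A B)"
proof
  show "commutator_subgroup (GL n R) (elementary n R A) (elementary n R B)
      \<subseteq> rel_elementary n R (sym_ideal_prod R A B)"
    \<comment> \<open>The commutator subgroup lies in every member of the family being
      intersected.\<close>
    unfolding rel_elementary_def normal_closure_def
    using ring.commutator_subgroup_elementary_subset[OF assms] by blast
  show "rel_elementary n R (sym_ideal_prod R A B)
      \<subseteq> commutator_subgroup (GL n R) (elementary n R A) (elementary n R B)"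
    \<comment> \<open>The commutator subgroup is itself a member of that family.\<close>
    unfolding rel_elementary_def normal_closure_def
    using ring.commutator_subgroup_normal[OF assms(1,3-5)]
      ring.elementary_sym_ideal_prod_subset[OF assms(1-4)] by blast
qed

end
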